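(* Let $R=S^G$ be the invariant subring of $S=\Bbbk[[x,y]]$ under the cyclic group $G=\frac1n(1,a)$, with $i$-series $(i_1,\dots,i_r)$. Let $t\in\{0,1,\dots,n-1\}$, and let $(d_{1,t},\dots,d_{r,t})$ be the sequence of non-negative integers obtained from $t$ by successive division by $i_1,\dots,i_r$, so that $t=d_{1,t}i_1+\cdots+d_{r,t}i_r$. Then $$\mu_R(M_t)=d_{1,t}+d_{2,t}+\cdots+d_{r,t}+1.$$
   Context: $\Bbbk$ is an algebraically closed field; $n,a$ are integers with $1\le a\le n-1$, $\gcd(a,n)=1$, and $n$ is invertible in $\Bbbk$. $\frac1n(1,a)$ denotes the cyclic group generated by $\sigma=\mathrm{diag}(\zeta_n,\zeta_n^a)$, $\zeta_n$ a primitive $n$-th root of unity, acting on $S=\Bbbk[[x,y]]$ by $x\mapsto\zeta_n x$, $y\mapsto\zeta_n^a y$. $R=S^G$ is a local ring with maximal ideal $\mathfrak m$. For an integer $t$, $M_t\subset S$ is the $R$-submodule generated by the monomials $x^iy^j$ with $i+ja\equiv t \pmod n$. $\mu_R(M)=\dim_\Bbbk M/\mathfrak mM$ denotes the minimal number of generators of $M$. $i$-series: write the Hirzebruch-Jung continued fraction $n/a=[\alpha_1,\dots,\alpha_r]=\alpha_1-\cfrac{1}{\alpha_2-\cfrac{1}{\cdots-\frac{1}{\alpha_r}}}$ with integers $\alpha_u\ge2$. Put $i_0=n$, $i_1=a$, $i_u=\alpha_{u-1}i_{u-1}-i_{u-2}$ for $u=2,\dots,r+1$; then $i_1>i_2>\cdots>i_r=1$,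 $i_{r+1}=0$. The $i$-series is $(i_1,\dots,i_r)$. Division: for $t\in\{0,\dots,n-1\}$, the $d_{u,t}\in\mathbb Z_{\ge0}$ are defined by $t=d_{1,t}i_1+h_{1,t}$ with $0\le h_{1,t}<i_1$, and $h_{u,t}=d_{u+1,t}i_{u+1}+h_{u+1,t}$ with $0\le h_{u+1,t}<i_{u+1}$ for $u=1,\dots,r-1$ (all $h_{u,t}$ integers, and $h_{r,t}=0$). *)

theory Defs
  imports
    "Jordan_Normal_Form.VS_Connect"
    "HOL-Algebra.QuotRing"
    "HOL-Computational_Algebra.Formal_Power_Series"
    "HOL-Number_Theory.Cong"
begin

section \<open>Modules: generation, quotients, minimal number of generators\<close>

text \<open>Meaningful for local rings only.\<close>

definition max_ideal :: "('r, 'e) ring_scheme \<Rightarrow> 'r set" where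
  "max_ideal R = (THE \<mm>. maximalideal \<mm> R)"

definition ideal_mult ::
  "('r, 'e) ring_scheme \<Rightarrow> 'r set \<Rightarrow> ('r, 'm, 'f) module_scheme \<Rightarrow> 'm set" where
  "ideal_mult R I M = LinearCombinations.module.span R M {r \<odot>\<^bsub>M\<^esub> z | r z. r \<in> I \<and> z \<in> carrier M}"

text \<open>The multiplicative part of a module record carries no information for modules;
  it is filled in trivially, as in \<^const>\<open>direct_sum\<close>. The scalar multiplication of cosets
  follows the pattern of \<^const>\<open>rcoset_mult\<close>.\<close>

definition quot_module :: "('r, 'm, 'f) module_scheme \<Rightarrow> 'm set \<Rightarrow> ('r, 'm set) module" where
  "quot_module M N =
    \<lparr>carrier = a_rcosets\<^bsub>M\<^esub> N, monoid.mult = (\<lambda>_ _. N), one = N, zero = N, add = set_add M,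
     smult = (\<lambda>r X. \<Union>x\<in>X. N +>\<^bsub>M\<^esub> (r \<odot>\<^bsub>M\<^esub> x))\<rparr>"

definition restrict_scalars ::
  "('k \<Rightarrow> 'r) \<Rightarrow> ('r, 'm, 'f) module_scheme \<Rightarrow> ('k, 'm) module" where
  "restrict_scalars \<phi> M =
    \<lparr>carrier = carrier M, monoid.mult = monoid.mult M, one = one M, zero = zero M, add = add M,
     smult = (\<lambda>c. smult M (\<phi> c))\<rparr>"

text \<open>\<open>\<phi>\<close> is the structure map of \<open>R\<close> as an algebra over the field \<open>'k\<close>.\<close>

definition min_num_gens ::
  "('k::field \<Rightarrow> 'r) \<Rightarrow> ('r, 'e) ring_scheme \<Rightarrow> ('r, 'm, 'f) module_scheme \<Rightarrow> nat" where
  "min_num_gens \<phi> R M =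
    vectorspace.dim (class_ring :: 'k ring)
      (restrict_scalars \<phi> (quot_module M (ideal_mult R (max_ideal R) M)))"


section \<open>Cyclic quotient singularities\<close>

text \<open>\<open>\<k>[[x,y]]\<close> is represented as \<open>\<k>[[x]][[y]]\<close>, i.e. by the type \<open>'k fps fps\<close>: the inner
  variable is \<open>x\<close>, the outer one is \<open>y\<close>, and the coefficient of \<open>x^i y^j\<close> in \<open>f\<close> is
  \<open>fps_nth (fps_nth f j) i\<close>.\<close>

definition const_xy :: "'k::field \<Rightarrow> 'k fps fps" where
  "const_xy c = fps_const (fps_const c)"

definition var_x :: "'k::field fps fps" where
  "var_x = fps_const fps_X"

definition var_y :: "'k::field fps fps" where
  "var_y = fps_X"

text \<open>The substitution \<open>f(x, y) \<mapsto> f(\<alpha> x, \<beta> y)\<close>: first \<open>x \<mapsto> \<alpha> x\<close> in each coefficient of a power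
  of \<open>y\<close>, then \<open>y \<mapsto> \<beta> y\<close>.\<close>

definition diag_act :: "'k::field \<times> 'k \<Rightarrow> 'k fps fps \<Rightarrow> 'k fps fps" where
  "diag_act g f =
    fps_compose (Abs_fps (\<lambda>j. fps_compose (fps_nth f j) (fps_const (fst g) * fps_X)))
      (const_xy (snd g) * var_y)"

lemma diag_act_nth:
  "fps_nth (fps_nth (diag_act g f) j) i = fst g ^ i * snd g ^ j * fps_nth (fps_nth f j) i"
  by (simp add: diag_act_def const_xy_def var_y_def fps_compose_linear fps_const_power)

lemma diag_act_var_x: "diag_act g var_x = const_xy (fst g) * var_x"
  by (rule fps_ext, rule fps_ext) (auto simp: diag_act_nth var_x_def const_xy_def fps_X_def)

lemma diag_act_var_y: "diag_act g var_y = const_xy (snd g) * var_y"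
  by (rule fps_ext, rule fps_ext) (auto simp: diag_act_nth var_y_def const_xy_def fps_X_def)

definition primitive_root_of_unity :: "nat \<Rightarrow> 'k::field \<Rightarrow> bool" where
  "primitive_root_of_unity n \<zeta> \<longleftrightarrow> n > 0 \<and> \<zeta> ^ n = 1 \<and> (\<forall>k. 0 < k \<and> k < n \<longrightarrow> \<zeta> ^ k \<noteq> 1)"

text \<open>The group generated by \<open>diag(\<zeta>, \<zeta>^a)\<close>, a diagonal matrix being represented by the pair of
  its diagonal entries. For \<open>\<zeta>\<close> a root of unity the non-negative powers form the whole group.\<close>

definition cyclic_group :: "nat \<Rightarrow> 'k::field \<Rightarrow> ('k \<times> 'k) set" where
  "cyclic_group a \<zeta> = {(\<zeta> ^ k, (\<zeta> ^ a) ^ k) | k. True}"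

definition invariant_ring :: "('k::field \<times> 'k) set \<Rightarrow> 'k fps fps ring" where
  "invariant_ring G = class_ring \<lparr>carrier := {f. \<forall>g\<in>G. diag_act g f = f}\<rparr>"

text \<open>The power series ring as a module, with scalars acting by multiplication.\<close>

definition S_module :: "('k::field fps fps, 'k fps fps) module" where
  "S_module = \<lparr>carrier = UNIV, monoid.mult = (*), one = 1, zero = 0, add = (+), smult = (*)\<rparr>"

definition M_module ::
  "nat \<Rightarrow> nat \<Rightarrow> 'k::field \<Rightarrow> int \<Rightarrow> ('k fps fps, 'k fps fps) module" where
  "M_module n a \<zeta> t = S_module
    \<lparr>carrier := LinearCombinations.module.span (invariant_ring (cyclic_group a \<zeta>)) S_module
       {var_x ^ i * var_y ^ j | i j. [int i + int j * int a = t] (mod int n)}\<rparr>"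


section \<open>Hirzebruch-Jung continued fractions, the i-series and successive division\<close>

fun hj_cf :: "int list \<Rightarrow> rat" where
  "hj_cf [] = 0"
| "hj_cf [\<alpha>] = of_int \<alpha>"
| "hj_cf (\<alpha> # \<beta> # \<alpha>s) = of_int \<alpha> - 1 / hj_cf (\<beta> # \<alpha>s)"

definition hj_expansion :: "int list \<Rightarrow> rat \<Rightarrow> bool" where
  "hj_expansion \<alpha>s q \<longleftrightarrow> \<alpha>s \<noteq> [] \<and> (\<forall>\<alpha>\<in>set \<alpha>s. \<alpha> \<ge> 2) \<and> q = hj_cf \<alpha>s"

text \<open>The sequence \<open>i_0, i_1, \<dots>, i_{r+1}\<close> for \<open>\<alpha>s = [\<alpha>_1, \<dots>, \<alpha>_r]\<close>. Since list indices start at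
  0, \<open>\<alpha>_{u+1}\<close> is \<open>\<alpha>s ! u\<close>. Only the values at \<open>u \<le> r + 1\<close> are meaningful.\<close>

fun i_series :: "nat \<Rightarrow> nat \<Rightarrow> int list \<Rightarrow> nat \<Rightarrow> int" where
  "i_series n a \<alpha>s 0 = int n"
| "i_series n a \<alpha>s (Suc 0) = int a"
| "i_series n a \<alpha>s (Suc (Suc u)) =
     (\<alpha>s ! u) * i_series n a \<alpha>s (Suc u) - i_series n a \<alpha>s u"

text \<open>Successive division of \<open>t\<close> by \<open>i 1, i 2, \<dots>\<close>: the remainders \<open>h_u\<close>, with \<open>h_0 = t\<close>, and for
  \<open>u \<ge> 1\<close> the quotients \<open>d_u\<close>.\<close>

primrec div_rem :: "(nat \<Rightarrow> int) \<Rightarrow> int \<Rightarrow> nat \<Rightarrow> int" where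
  "div_rem i t 0 = t"
| "div_rem i t (Suc u) = div_rem i t u mod i (Suc u)"

definition div_quot :: "(nat \<Rightarrow> int) \<Rightarrow> int \<Rightarrow> nat \<Rightarrow> int" where
  "div_quot i t u = div_rem i t (u - 1) div i u"

end

theory Submission
  imports Defs
begin

text \<open>
  Call \<open>i + j * a\<close> modulo \<open>n\<close> the weight of the monomial \<open>x ^ i * y ^ j\<close>. The invariant ring
  \<open>R\<close> consists of the power series of weight zero, \<open>M\<^sub>t\<close> of those of weight \<open>t\<close>, and the maximal
  ideal of \<open>R\<close> of the elements with vanishing constant term. Consider the monomials of weight
  \<open>t\<close> that are minimal for divisibility among all monomials of this weight; there are finitely
  many. Sorting the terms of a power series by the minimal monomials that divide them
  (\<open>weight_space_decompose\<close>) shows that they generate \<open>M\<^sub>t\<close>, and that the product of \<open>M\<^sub>t\<close> with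
  the maximal ideal consists of the series in which no minimal monomial occurs
  (\<open>max_ideal_mult_M\<close>). Hence the minimal number of generators is the number of minimal
  monomials (\<open>min_num_gens_M\<close>).

  Counting these is elementary. For a given exponent \<open>j\<close> of \<open>y\<close>, the least exponent of \<open>x\<close> is
  \<open>(t - j * a) mod n\<close>, so minimal monomials correspond to the records, that is, the strict
  running minima, of this sequence in \<open>j\<close> (\<open>card_min_exponents\<close>). The sequence starts at
  \<open>t\<close> and descends in steps of \<open>a\<close> to \<open>t mod a\<close>, which gives \<open>t div a\<close> records before the last
  value. From then on only values below \<open>a\<close> can be records, and the subsequence of these values
  is again of the same form, with \<open>n\<close>, \<open>a\<close>, \<open>t\<close> replaced by \<open>a\<close>, \<open>b\<close>, \<open>t mod a\<close> for
  any \<open>b\<close> congruent to \<open>- n\<close> modulo \<open>a\<close> (\<open>records_walk_reduce\<close>). With \<open>b = \<alpha> * a - n\<close>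
  this is one step of the Hirzebruch-Jung continued fraction, of the i-series, and of the
  successive division of \<open>t\<close>. Iterating down to \<open>(1, 0)\<close>, where only the value \<open>0\<close> is left, the
  numbers of records add up to the sum of the quotients plus one (\<open>card_records_walk\<close>).
\<close>

no_notation vec_index (infixl "$" 100)
unbundle fps_syntax

section \<open>Vector spaces with coordinates\<close>

text \<open>
  A family of vectors with a dual family of linear functionals that separates points is a basis:
  the functionals read off the coefficients of a linear combination, which gives independence,
  and \<open>v\<close> minus the combination with coefficients \<open>c w v\<close> is killed by all functionals, which gives
  generation. For a quotient space this is convenient, because the coefficient functionals
  descend to cosets while linear combinations of cosets are awkward to handle directly.
\<close>

lemma (in vectorspace) dim_eq_card_of_coordinates:
  assumes fin: "finite W"
    and e: "\<And>w. w \<in> W \<Longrightarrow> e w \<in> carrier V"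
    and c_closed: "\<And>w v. \<lbrakk>w \<in> W; v \<in> carrier V\<rbrakk> \<Longrightarrow> c w v \<in> carrier K"
    and c_add: "\<And>w u v. \<lbrakk>w \<in> W; u \<in> carrier V; v \<in> carrier V\<rbrakk> \<Longrightarrow> c w (u \<oplus>\<^bsub>V\<^esub> v) = c w u \<oplus>\<^bsub>K\<^esub> c w v"
    and c_smult: "\<And>w r v. \<lbrakk>w \<in> W; r \<in> carrier K; v \<in> carrier V\<rbrakk> \<Longrightarrow> c w (r \<odot>\<^bsub>V\<^esub> v) = r \<otimes>\<^bsub>K\<^esub> c w v"
    and dual: "\<And>w w'. \<lbrakk>w \<in> W; w' \<in> W\<rbrakk> \<Longrightarrow> c w (e w') = (if w = w' then \<one>\<^bsub>K\<^esub> else \<zero>\<^bsub>K\<^esub>)"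
    and separate: "\<And>v. \<lbrakk>v \<in> carrier V; \<And>w. w \<in> W \<Longrightarrow> c w v = \<zero>\<^bsub>K\<^esub>\<rbrakk> \<Longrightarrow> v = \<zero>\<^bsub>V\<^esub>"
  shows "dim = card W"
proof -
  have inj: "inj_on e W"
  proof (rule inj_onI)
    fix w w' assume w: "w \<in> W" "w' \<in> W" and "e w = e w'"
    then have "c w (e w') = \<one>\<^bsub>K\<^esub>" using dual [of w w] by simp
    then show "w = w'" using dual [of w w'] w by (auto split: if_splits)
  qed
  have c_zero: "c w \<zero>\<^bsub>V\<^esub> = \<zero>\<^bsub>K\<^esub>" if "w \<in> W" for w
    using c_smult [of w "\<zero>\<^bsub>K\<^esub>" "\<zero>\<^bsub>V\<^esub>"] c_closed [of w "\<zero>\<^bsub>V\<^esub>"] that by simp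
  have coord: "c w (lincomb a (e ` U)) = (if w \<in> U then a (e w) else \<zero>\<^bsub>K\<^esub>)"
    if "finite U" "U \<subseteq> W" "w \<in> W" "a \<in> e ` U \<rightarrow> carrier K" for a U w
    using that
  proof (induction U)
    case empty
    then show ?case by (simp add: lincomb_def c_zero)
  next
    case (insert u U)
    have "e u \<notin> e ` U" using insert.hyps insert.prems inj by (auto dest: inj_onD)
    moreover have U: "e ` U \<subseteq> carrier V" "e u \<in> carrier V" using insert.prems e by auto
    moreover have a: "a (e u) \<in> carrier K" "a \<in> e ` U \<rightarrow> carrier K" using insert.prems by auto
    ultimately have "lincomb a (e ` insert u U) = a (e u) \<odot>\<^bsub>V\<^esub> e u \<oplus>\<^bsub>V\<^esub> lincomb a (e ` U)"
      using lincomb_insert [of "e ` U" a "e u"] insert.hyps by auto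
    then have "c w (lincomb a (e ` insert u U)) =
        a (e u) \<otimes>\<^bsub>K\<^esub> c w (e u) \<oplus>\<^bsub>K\<^esub> (if w \<in> U then a (e w) else \<zero>\<^bsub>K\<^esub>)"
      using U a insert by (simp add: c_add c_smult)
    then show ?case
      using dual [of w u] a insert by (auto simp: Pi_iff)
  qed
  have eW: "e ` W \<subseteq> carrier V" using e by auto
  have "lin_indpt (e ` W)"
  proof
    assume "lin_dep (e ` W)"
    then obtain A a v where A: "finite A" "A \<subseteq> e ` W" "a \<in> A \<rightarrow> carrier K"
      "lincomb a A = \<zero>\<^bsub>V\<^esub>" "v \<in> A" "a v \<noteq> \<zero>\<^bsub>K\<^esub>"
      unfolding lin_dep_def by blast
    obtain U where U: "U \<subseteq> W" "A = e ` U"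
      using A(2) by (meson subset_imageE)
    then obtain w where w: "w \<in> U" "v = e w" using A(5) by auto
    have "finite U" using U fin finite_subset by blast
    then have "c w (lincomb a A) = a v"
      using coord [of U w a] U w A by auto
    then show False using A c_zero [of w] U w by auto
  qed
  moreover have "span (e ` W) = carrier V"
  proof
    show "span (e ` W) \<subseteq> carrier V" using span_is_subset2 [OF eW] by simp
    show "carrier V \<subseteq> span (e ` W)"
    proof
      fix v assume v: "v \<in> carrier V"
      define a where "a = (\<lambda>x. c (inv_into W e x) v)"
      have a: "a \<in> e ` W \<rightarrow> carrier K"
        using c_closed v inj by (auto simp: a_def)
      define u where "u = lincomb a (e ` W)"
      have u: "u \<in> carrier V" unfolding u_def using eW a by blast
      have "v \<ominus>\<^bsub>V\<^esub> u = \<zero>\<^bsub>V\<^esub>"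
      proof (rule separate)
        show "v \<ominus>\<^bsub>V\<^esub> u \<in> carrier V" using u v by simp
        fix w assume w: "w \<in> W"
        have "c w u = c w v"
          unfolding u_def using coord [OF fin order.refl w a] w inj by (simp add: a_def)
        moreover have "c w v = c w (v \<ominus>\<^bsub>V\<^esub> u) \<oplus>\<^bsub>K\<^esub> c w u"
          using c_add [OF w, of "v \<ominus>\<^bsub>V\<^esub> u" u] u v
          by (simp add: M.minus_eq M.a_assoc M.l_neg)
        ultimately show "c w (v \<ominus>\<^bsub>V\<^esub> u) = \<zero>\<^bsub>K\<^esub>"
          using c_closed [OF w, of v] c_closed [OF w, of "v \<ominus>\<^bsub>V\<^esub> u"] u v
          by (simp add: R.add.l_cancel_one')
      qed
      moreover have "(v \<ominus>\<^bsub>V\<^esub> u) \<oplus>\<^bsub>V\<^esub> u = v"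
        using u v by (simp add: M.minus_eq M.a_assoc M.l_neg)
      ultimately have "v = u" using u by simp
      then show "v \<in> span (e ` W)"
        unfolding u_def span_def using fin a by blast
    qed
  qed
  ultimately have "basis (e ` W)" using eW by (simp add: basis_def)
  then have "dim = card (e ` W)" using fin by (intro dim_basis) auto
  then show ?thesis using inj by (simp add: card_image)
qed

section \<open>Quotient modules and restriction of scalars\<close>

context submodule
begin

lemma abelian_subgroup_add: "abelian_subgroup N M"
proof -
  interpret Module.module R M by (rule module)
  show ?thesis
  proof (rule abelian_subgroupI3)
    show "additive_subgroup N M"
    proof (rule additive_subgroup.intro, rule subgroup.intro)
      show "N \<subseteq> carrier (add_monoid M)" using subset by simp
      show "inv\<^bsub>add_monoid M\<^esub> x \<in> N" if "x \<in> N" for x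
      proof -
        have "\<ominus>\<^bsub>M\<^esub> x = (\<ominus>\<^bsub>R\<^esub> \<one>\<^bsub>R\<^esub>) \<odot> x" using that subset smult_minus_1 by auto
        then show ?thesis using that by (simp add: a_inv_def)
      qed
    qed auto
    show "abelian_group M" ..
  qed
qed

text \<open>The union over the representatives in the definition of the scalar product consists of
  equal cosets, as \<open>N\<close> is closed under scalars.\<close>

lemma smult_coset:
  assumes "r \<in> carrier R" "x \<in> carrier M"
  shows "r \<odot>\<^bsub>quot_module M N\<^esub> (N +> x) = N +> (r \<odot> x)"
proof -
  interpret Module.module R M by (rule module)
  interpret abelian_subgroup N M by (rule abelian_subgroup_add)
  have "N +> (r \<odot> y) = N +> (r \<odot> x)" if y: "y \<in> N +> x" for y
  proof -
    obtain h where h: "h \<in> N" "y = h \<oplus> x"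
      using y by (auto simp: a_r_coset_def')
    then have "h \<in> carrier M" using subset by auto
    then have "r \<odot> y = r \<odot> h \<oplus> r \<odot> x" using h assms by (simp add: smult_r_distr)
    moreover have "r \<odot> h \<in> N" using h assms by simp
    ultimately have "r \<odot> y \<in> N +> (r \<odot> x)" by (auto simp: a_r_coset_def')
    then show ?thesis
      using assms by (intro a_repr_independence' [symmetric]) auto
  qed
  then have "(\<Union>y\<in>N +> x. N +> (r \<odot> y)) = (\<Union>y\<in>N +> x. N +> (r \<odot> x))"
    by (intro SUP_cong) auto
  moreover have "N +> x \<noteq> {}" using a_rcos_self [OF assms(2)] by blast
  ultimately show ?thesis by (simp add: quot_module_def)
qed

lemma quot_module_is_module: "Module.module R (quot_module M N)"
proof -
  interpret Module.module R M by (rule module)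
  interpret abelian_subgroup N M by (rule abelian_subgroup_add)
  let ?Q = "quot_module M N"
  have cosetE: "\<exists>x\<in>carrier M. X = N +> x" if "X \<in> carrier ?Q" for X
    using that by (auto simp: quot_module_def A_RCOSETS_def')
  have coset: "N +> x \<in> carrier ?Q" if "x \<in> carrier M" for x
    using that by (auto simp: quot_module_def A_RCOSETS_def')
  have add: "(N +> x) \<oplus>\<^bsub>?Q\<^esub> (N +> y) = N +> (x \<oplus> y)" if "x \<in> carrier M" "y \<in> carrier M" for x y
    using that a_rcos_sum by (simp add: quot_module_def)
  have zero: "\<zero>\<^bsub>?Q\<^esub> = N +> \<zero>"
    using a_coset_add_zero subset by (simp add: quot_module_def)
  have ab: "abelian_group ?Q"
  proof (rule abelian_groupI)
    show "\<zero>\<^bsub>?Q\<^esub> \<in> carrier ?Q" by (simp add: zero coset)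
    fix X assume "X \<in> carrier ?Q"
    then obtain x where x: "x \<in> carrier M" "X = N +> x" using cosetE by blast
    show "\<zero>\<^bsub>?Q\<^esub> \<oplus>\<^bsub>?Q\<^esub> X = X" using x by (simp add: zero add)
    show "\<exists>Y\<in>carrier ?Q. Y \<oplus>\<^bsub>?Q\<^esub> X = \<zero>\<^bsub>?Q\<^esub>"
      using x by (intro bexI [of _ "N +> (\<ominus> x)"]) (simp_all add: zero add coset M.l_neg)
    fix Y assume "Y \<in> carrier ?Q"
    then obtain y where y: "y \<in> carrier M" "Y = N +> y" using cosetE by blast
    show "X \<oplus>\<^bsub>?Q\<^esub> Y \<in> carrier ?Q" using x y by (simp add: add coset)
    show "X \<oplus>\<^bsub>?Q\<^esub> Y = Y \<oplus>\<^bsub>?Q\<^esub> X" using x y by (simp add: add M.a_comm)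
    fix Z assume "Z \<in> carrier ?Q"
    then obtain z where z: "z \<in> carrier M" "Z = N +> z" using cosetE by blast
    show "X \<oplus>\<^bsub>?Q\<^esub> Y \<oplus>\<^bsub>?Q\<^esub> Z = X \<oplus>\<^bsub>?Q\<^esub> (Y \<oplus>\<^bsub>?Q\<^esub> Z)"
      using x y z by (simp add: add M.a_assoc)
  qed
  show ?thesis
  proof (rule moduleI)
    show "cring R" ..
    show "abelian_group ?Q" by (rule ab)
    fix r X assume r: "r \<in> carrier R" and X: "X \<in> carrier ?Q"
    obtain x where x: "x \<in> carrier M" "X = N +> x" using cosetE [OF X] by auto
    show "r \<odot>\<^bsub>?Q\<^esub> X \<in> carrier ?Q"
      using r x by (simp add: smult_coset coset)
    fix s assume s: "s \<in> carrier R"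
    show "(r \<oplus>\<^bsub>R\<^esub> s) \<odot>\<^bsub>?Q\<^esub> X = r \<odot>\<^bsub>?Q\<^esub> X \<oplus>\<^bsub>?Q\<^esub> s \<odot>\<^bsub>?Q\<^esub> X"
      using r s x by (simp add: smult_coset add smult_l_distr)
    show "(r \<otimes>\<^bsub>R\<^esub> s) \<odot>\<^bsub>?Q\<^esub> X = r \<odot>\<^bsub>?Q\<^esub> (s \<odot>\<^bsub>?Q\<^esub> X)"
      using r s x by (simp add: smult_coset smult_assoc1)
  next
    fix r X Y assume r: "r \<in> carrier R" and XY: "X \<in> carrier ?Q" "Y \<in> carrier ?Q"
    obtain x y where x: "x \<in> carrier M" "X = N +> x" "y \<in> carrier M" "Y = N +> y"
      using cosetE XY by metis
    show "r \<odot>\<^bsub>?Q\<^esub> (X \<oplus>\<^bsub>?Q\<^esub> Y) = r \<odot>\<^bsub>?Q\<^esub> X \<oplus>\<^bsub>?Q\<^esub> r \<odot>\<^bsub>?Q\<^esub> Y"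
      using r x by (simp add: smult_coset add smult_r_distr)
  next
    fix X assume "X \<in> carrier ?Q"
    then obtain x where x: "x \<in> carrier M" "X = N +> x" using cosetE by blast
    show "\<one>\<^bsub>R\<^esub> \<odot>\<^bsub>?Q\<^esub> X = X"
      using x by (simp add: smult_coset)
  qed
qed

end

lemma restrict_scalars_is_module:
  assumes "Module.module R M" "cring K" and \<phi>: "\<phi> \<in> Ring.ring_hom K R"
  shows "Module.module K (restrict_scalars \<phi> M)"
proof -
  interpret M: Module.module R M by fact
  let ?N = "restrict_scalars \<phi> M"
  have [simp]: "carrier ?N = carrier M" "\<zero>\<^bsub>?N\<^esub> = \<zero>\<^bsub>M\<^esub>" "x \<oplus>\<^bsub>?N\<^esub> y = x \<oplus>\<^bsub>M\<^esub> y"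
    "c \<odot>\<^bsub>?N\<^esub> x = \<phi> c \<odot>\<^bsub>M\<^esub> x" for x y c
    by (simp_all add: restrict_scalars_def)
  have "abelian_group ?N"
  proof (rule abelian_groupI)
    show "\<exists>y\<in>carrier ?N. y \<oplus>\<^bsub>?N\<^esub> x = \<zero>\<^bsub>?N\<^esub>" if "x \<in> carrier ?N" for x
      using that M.l_neg [of x] by (intro bexI [of _ "\<ominus>\<^bsub>M\<^esub> x"]) simp_all
  qed (simp_all add: M.a_ac)
  then show ?thesis
    using ring_hom_closed [OF \<phi>]
    by (intro moduleI \<open>cring K\<close>)
      (simp_all add: ring_hom_add [OF \<phi>] ring_hom_mult [OF \<phi>] ring_hom_one [OF \<phi>]
        M.smult_l_distr M.smult_r_distr M.smult_assoc1)
qed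

section \<open>The maximal ideal of a local ring\<close>

text \<open>If everything outside a proper ideal \<open>I\<close> is a unit, then \<open>I\<close> contains every proper
  ideal, hence is the only maximal one.\<close>

lemma max_ideal_eqI:
  assumes "ideal I R" and proper: "\<one>\<^bsub>R\<^esub> \<notin> I"
    and unit: "\<And>x. \<lbrakk>x \<in> carrier R; x \<notin> I\<rbrakk> \<Longrightarrow> \<exists>y\<in>carrier R. y \<otimes>\<^bsub>R\<^esub> x = \<one>\<^bsub>R\<^esub>"
  shows "max_ideal R = I"
proof -
  interpret I: ideal I R by fact
  have sub: "J \<subseteq> I" if "ideal J R" "J \<noteq> carrier R" for J
  proof
    fix x assume x: "x \<in> J"
    interpret J: ideal J R by fact
    show "x \<in> I"
    proof (rule ccontr)
      assume "x \<notin> I"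
      then obtain y where "y \<in> carrier R" "y \<otimes>\<^bsub>R\<^esub> x = \<one>\<^bsub>R\<^esub>" using unit x J.a_subset by blast
      then have "\<one>\<^bsub>R\<^esub> \<in> J" using J.I_l_closed [OF x] by metis
      then show False using J.one_imp_carrier that(2) by simp
    qed
  qed
  have "carrier R \<noteq> I" using proper by auto
  show ?thesis
    unfolding max_ideal_def
  proof (rule the_equality)
    show "maximalideal I R"
      using \<open>carrier R \<noteq> I\<close> sub by (intro maximalidealI) (use assms(1) in auto)
    fix J assume J: "maximalideal J R"
    then interpret J: maximalideal J R .
    have "J \<subseteq> I" using sub J.I_notcarr J.is_ideal by auto
    then show "J = I"
      using J.I_maximal [OF assms(1)] \<open>carrier R \<noteq> I\<close> I.a_subset by auto
  qed
qed

section \<open>Power series of a given weight\<close>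

definition weight_eq :: "nat \<Rightarrow> nat \<Rightarrow> int \<Rightarrow> nat \<Rightarrow> nat \<Rightarrow> bool" where
  "weight_eq n a t i j \<longleftrightarrow> [int i + int j * int a = t] (mod int n)"

definition weight_space :: "nat \<Rightarrow> nat \<Rightarrow> int \<Rightarrow> 'k::field fps fps set" where
  "weight_space n a t = {f. \<forall>i j. f $ j $ i \<noteq> 0 \<longrightarrow> weight_eq n a t i j}"

text \<open>The exponents of the monomials that no other monomial of the same weight divides.\<close>

definition min_exponents :: "nat \<Rightarrow> nat \<Rightarrow> int \<Rightarrow> (nat \<times> nat) set" where
  "min_exponents n a t = {(i, j). weight_eq n a t i j \<and>
    (\<forall>i' j'. weight_eq n a t i' j' \<and> i' \<le> i \<and> j' \<le> j \<longrightarrow> i' = i \<and> j' = j)}"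

lemma weight_eq_add:
  "weight_eq n a s i j \<Longrightarrow> weight_eq n a t i' j' \<Longrightarrow> weight_eq n a (s + t) (i + i') (j + j')"
  unfolding weight_eq_def using cong_add by (fastforce simp: algebra_simps)

lemma weight_eq_diff:
  "weight_eq n a (s + t) (i + i') (j + j') \<Longrightarrow> weight_eq n a t i' j' \<Longrightarrow> weight_eq n a s i j"
  unfolding weight_eq_def using cong_diff by (fastforce simp: algebra_simps)

lemma sum_mem:
  assumes "0 \<in> N" "\<And>x y. x \<in> N \<Longrightarrow> y \<in> N \<Longrightarrow> x + y \<in> N" "\<And>w. w \<in> A \<Longrightarrow> g w \<in> N"
  shows "sum g A \<in> N"
  using assms(3) by (induction A rule: infinite_finite_induct) (auto intro: assms(1,2))

lemma nth_mult_xy: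
  fixes f g :: "'k::field fps fps"
  shows "(f * g) $ j $ i = (\<Sum>q\<le>j. \<Sum>p\<le>i. f $ q $ p * g $ (j - q) $ (i - p))"
  by (simp add: fps_mult_nth fps_sum_nth atLeast0AtMost)

lemma nth_monomial_mult:
  fixes f :: "'k::field fps fps"
  shows "(var_x ^ p * var_y ^ q * f) $ j $ i = (if p \<le> i \<and> q \<le> j then f $ (j - q) $ (i - p) else 0)"
  by (simp add: var_x_def var_y_def fps_const_power mult.assoc fps_X_power_mult_nth)

lemma nth_monomial:
  "(var_x ^ p * var_y ^ q :: 'k::field fps fps) $ j $ i = (if i = p \<and> j = q then 1 else 0)"
  using nth_monomial_mult [of p q "1 :: 'k fps fps" j i] by auto

lemma nth_const_xy_mult: "(const_xy c * f) $ j $ i = c * f $ j $ i"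
  by (simp add: const_xy_def)

lemma weight_space_mult:
  assumes "f \<in> weight_space n a s" "g \<in> weight_space n a t"
  shows "f * g \<in> weight_space n a (s + t)"
  unfolding weight_space_def
proof (safe, rule ccontr)
  fix i j assume nz: "(f * g) $ j $ i \<noteq> 0" and nw: "\<not> weight_eq n a (s + t) i j"
  have "f $ q $ p * g $ (j - q) $ (i - p) = 0" if "q \<le> j" "p \<le> i" for p q
    using weight_eq_add [of n a s p q t "i - p" "j - q"] nw that assms
    by (auto simp: weight_space_def)
  then have "(f * g) $ j $ i = 0"
    unfolding nth_mult_xy by (intro sum.neutral ballI) auto
  with nz show False by simp
qed

lemma weight_space_add:
  "f \<in> weight_space n a t \<Longrightarrow> g \<in> weight_space n a t \<Longrightarrow> f + g \<in> weight_space n a t"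
  by (auto simp: weight_space_def) (metis add.right_neutral add.left_neutral)

lemma weight_space_uminus: "f \<in> weight_space n a t \<Longrightarrow> - f \<in> weight_space n a t"
  by (auto simp: weight_space_def)

lemma zero_in_weight_space: "0 \<in> weight_space n a t"
  by (simp add: weight_space_def)

lemma monomial_in_weight_space:
  "weight_eq n a t i j \<Longrightarrow> var_x ^ i * var_y ^ j \<in> weight_space n a t"
  by (simp add: weight_space_def nth_monomial)

lemma const_xy_in_weight_space: "const_xy c \<in> weight_space n a 0"
  using nth_const_xy_mult [of c 1] by (auto simp: weight_space_def weight_eq_def split: if_splits)

lemma one_in_weight_space: "1 \<in> weight_space n a 0"
  using monomial_in_weight_space [of n a 0 0 0] by (simp add: weight_eq_def)

text \<open>Both \<open>x ^ n\<close> and \<open>y ^ n\<close> have weight zero, so a minimal monomial is divisible by neither.\<close>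

lemma finite_min_exponents:
  assumes "n > 0" shows "finite (min_exponents n a t)"
proof (rule finite_subset)
  have "i < n \<and> j < n" if ij: "(i, j) \<in> min_exponents n a t" for i j
  proof (rule conjI; rule ccontr)
    assume "\<not> i < n"
    then have "weight_eq n a t (i - n) j"
      using ij weight_eq_diff [of n a t 0 "i - n" n j 0]
      by (simp add: min_exponents_def weight_eq_def cong_0_iff)
    then show False using ij \<open>\<not> i < n\<close> assms by (force simp: min_exponents_def)
  next
    assume "\<not> j < n"
    then have "weight_eq n a t i (j - n)"
      using ij weight_eq_diff [of n a t 0 i 0 "j - n" n]
      by (simp add: min_exponents_def weight_eq_def cong_0_iff)
    then show False using ij \<open>\<not> j < n\<close> assms by (force simp: min_exponents_def)
  qed
  then show "min_exponents n a t \<subseteq> {..<n} \<times> {..<n}" by auto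
qed simp

lemma min_exponents_below:
  assumes "weight_eq n a t i j"
  shows "\<exists>p q. (p, q) \<in> min_exponents n a t \<and> p \<le> i \<and> q \<le> j"
  using assms
proof (induction "i + j" arbitrary: i j rule: less_induct)
  case less
  show ?case
  proof (cases "(i, j) \<in> min_exponents n a t")
    case False
    then obtain i' j' where *: "weight_eq n a t i' j'" "i' \<le> i" "j' \<le> j" "i' \<noteq> i \<or> j' \<noteq> j"
      using less.prems by (auto simp: min_exponents_def)
    then have "i' + j' < i + j" by linarith
    then show ?thesis using less.hyps [of i' j'] * by (meson le_trans)
  qed auto
qed

text \<open>
  Every monomial of \<open>f\<close> is divisible by a minimal one of the same weight. Choosing one divisor
  for each monomial and collecting the monomials with the same choice yields the coefficients
  \<open>r\<close>. A minimal monomial can only choose itself, so the constant terms of \<open>r\<close> are the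
  coefficients of \<open>f\<close> at the minimal monomials. This single decomposition shows both that the
  minimal monomials generate and, when those coefficients vanish, that \<open>f\<close> lies in the product
  with the maximal ideal.
\<close>

lemma weight_space_decompose:
  fixes f :: "'k::field fps fps"
  assumes "n > 0" and f: "f \<in> weight_space n a t"
  obtains r where "\<And>p q. (p, q) \<in> min_exponents n a t \<Longrightarrow> r (p, q) \<in> weight_space n a 0"
    and "\<And>p q. (p, q) \<in> min_exponents n a t \<Longrightarrow> r (p, q) $ 0 $ 0 = f $ q $ p"
    and "f = (\<Sum>(p, q)\<in>min_exponents n a t. r (p, q) * (var_x ^ p * var_y ^ q))"
proof -
  let ?W = "min_exponents n a t"
  define c where "c = (\<lambda>i j. SOME w. w \<in> ?W \<and> fst w \<le> i \<and> snd w \<le> j)"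
  define r :: "nat \<times> nat \<Rightarrow> 'k fps fps" where
    "r = (\<lambda>w. Abs_fps (\<lambda>j. Abs_fps (\<lambda>i.
      if c (i + fst w) (j + snd w) = w then f $ (j + snd w) $ (i + fst w) else 0)))"
  have c: "c i j \<in> ?W \<and> fst (c i j) \<le> i \<and> snd (c i j) \<le> j" if "weight_eq n a t i j" for i j
    unfolding c_def by (rule someI_ex) (use min_exponents_below [OF that] in auto)
  have c_min: "c p q = (p, q)" if pq: "(p, q) \<in> ?W" for p q
  proof -
    have "weight_eq n a t p q" using pq by (simp add: min_exponents_def)
    from c [OF this] show ?thesis
      using pq by (cases "c p q") (auto simp: min_exponents_def)
  qed
  have "r (p, q) \<in> weight_space n a 0" if "(p, q) \<in> ?W" for p q
  proof -
    have "weight_eq n a 0 i j" if "f $ (j + q) $ (i + p) \<noteq> 0" for i j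
      using that f \<open>(p, q) \<in> ?W\<close> weight_eq_diff [of n a 0 t i p j q]
      by (auto simp: weight_space_def min_exponents_def)
    then show ?thesis by (auto simp: weight_space_def r_def)
  qed
  moreover have "r (p, q) $ 0 $ 0 = f $ q $ p" if "(p, q) \<in> ?W" for p q
    using c_min [OF that] by (simp add: r_def)
  moreover have "f = (\<Sum>(p, q)\<in>?W. r (p, q) * (var_x ^ p * var_y ^ q))"
  proof (rule fps_ext, rule fps_ext)
    fix j i
    have nth_term: "(r w * (var_x ^ fst w * var_y ^ snd w)) $ j $ i =
        (if fst w \<le> i \<and> snd w \<le> j \<and> c i j = w then f $ j $ i else 0)" for w
      using nth_monomial_mult [of "fst w" "snd w" "r w" j i] by (simp add: r_def mult.commute)
    have "(\<Sum>(p, q)\<in>?W. r (p, q) * (var_x ^ p * var_y ^ q)) $ j $ i =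
        (\<Sum>w\<in>?W. if fst w \<le> i \<and> snd w \<le> j \<and> c i j = w then f $ j $ i else 0)"
      unfolding fps_sum_nth case_prod_unfold prod.collapse nth_term ..
    also have "\<dots> = f $ j $ i"
    proof (cases "f $ j $ i = 0")
      case False
      then have "weight_eq n a t i j" using f by (simp add: weight_space_def)
      note c = c [OF this]
      have "(\<Sum>w\<in>?W. if fst w \<le> i \<and> snd w \<le> j \<and> c i j = w then f $ j $ i else 0) =
          (\<Sum>w\<in>?W. if c i j = w then f $ j $ i else 0)"
        using c by (intro sum.cong) (auto split: if_splits)
      also have "\<dots> = f $ j $ i"
        using c finite_min_exponents [OF \<open>n > 0\<close>] by simp
      finally show ?thesis .
    qed simp
    finally show "f $ j $ i = (\<Sum>(p, q)\<in>?W. r (p, q) * (var_x ^ p * var_y ^ q)) $ j $ i" ..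
  qed
  ultimately show thesis by (rule that)
qed

section \<open>The invariant ring\<close>

lemma primitive_root_power_eq_1_iff:
  assumes "primitive_root_of_unity n \<zeta>"
  shows "\<zeta> ^ k = 1 \<longleftrightarrow> n dvd k"
proof
  assume "n dvd k"
  then show "\<zeta> ^ k = 1"
    using assms by (auto simp: primitive_root_of_unity_def power_mult)
next
  assume k: "\<zeta> ^ k = 1"
  have "\<zeta> ^ k = \<zeta> ^ (k mod n) * (\<zeta> ^ n) ^ (k div n)"
    by (metis mod_mult_div_eq power_add power_mult)
  then have "\<zeta> ^ (k mod n) = 1"
    using k assms by (simp add: primitive_root_of_unity_def)
  then have "\<not> 0 < k mod n"
    using assms by (auto simp: primitive_root_of_unity_def)
  then show "n dvd k" by (simp add: mod_eq_0_iff_dvd)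
qed

text \<open>The generator of the group multiplies \<open>x ^ i * y ^ j\<close> by \<open>\<zeta> ^ (i + a * j)\<close>, and this is
  one exactly when the monomial has weight zero.\<close>

lemma carrier_invariant_ring:
  assumes \<zeta>: "primitive_root_of_unity n \<zeta>"
  shows "carrier (invariant_ring (cyclic_group a \<zeta>)) = weight_space n a 0"
proof -
  have wt: "weight_eq n a 0 i j \<longleftrightarrow> \<zeta> ^ (i + a * j) = 1" for i j
  proof -
    have "int i + int j * int a = int (i + a * j)" by simp
    then show ?thesis
      unfolding weight_eq_def cong_0_iff primitive_root_power_eq_1_iff [OF \<zeta>]
      by (metis of_nat_dvd_iff)
  qed
  have nth: "diag_act (\<zeta> ^ k, (\<zeta> ^ a) ^ k) f $ j $ i = (\<zeta> ^ (i + a * j)) ^ k * f $ j $ i" for f k i j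
  proof -
    have "(\<zeta> ^ k) ^ i * ((\<zeta> ^ a) ^ k) ^ j = (\<zeta> ^ (i + a * j)) ^ k"
      by (simp add: power_add power_mult_distrib flip: power_mult) (simp add: ac_simps)
    then show ?thesis by (simp add: diag_act_nth)
  qed
  show ?thesis
  proof safe
    fix f assume "f \<in> carrier (invariant_ring (cyclic_group a \<zeta>))"
    moreover have "(\<zeta> ^ 1, (\<zeta> ^ a) ^ 1) \<in> cyclic_group a \<zeta>"
      unfolding cyclic_group_def by blast
    ultimately have "diag_act (\<zeta> ^ 1, (\<zeta> ^ a) ^ 1) f = f"
      by (simp add: invariant_ring_def)
    then have "\<zeta> ^ (i + a * j) * f $ j $ i = f $ j $ i" for i j
      using nth [of 1 f j i] by simp
    then show "f \<in> weight_space n a 0"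
      by (auto simp: weight_space_def wt)
  next
    fix f :: "'a fps fps" assume "f \<in> weight_space n a 0"
    then have "(\<zeta> ^ (i + a * j)) ^ k * f $ j $ i = f $ j $ i" for i j k
      by (cases "f $ j $ i = 0") (auto simp: weight_space_def wt)
    then have "diag_act (\<zeta> ^ k, (\<zeta> ^ a) ^ k) f = f" for k
      by (intro fps_ext) (simp add: nth)
    then show "f \<in> carrier (invariant_ring (cyclic_group a \<zeta>))"
      by (auto simp: invariant_ring_def cyclic_group_def)
  qed
qed

text \<open>
  The inverse \<open>h\<close> in the full power series ring exists since the constant term is a unit. Its part
  of weight zero is already an inverse: multiplication by \<open>f\<close> preserves weights, so the parts of
  \<open>h\<close> of other weights contribute nothing to the weight-zero series \<open>1\<close>.
\<close>

lemma weight_space_inverse: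
  fixes f :: "'k::field fps fps"
  assumes f: "f \<in> weight_space n a 0" and "f $ 0 $ 0 \<noteq> 0"
  shows "\<exists>g\<in>weight_space n a 0. g * f = 1"
proof -
  have "f $ 0 * inverse (f $ 0) = 1"
    using assms(2) by (simp add: inverse_mult_eq_1')
  then have "f * fps_right_inverse f (inverse (f $ 0)) = 1"
    by (rule fps_right_inverse)
  then obtain h where h: "f * h = 1" by blast
  define g where "g = Abs_fps (\<lambda>j. Abs_fps (\<lambda>i. if weight_eq n a 0 i j then h $ j $ i else 0))"
  have g: "g \<in> weight_space n a 0" by (simp add: weight_space_def g_def)
  have "(f * g) $ j $ i = (1 :: 'k fps fps) $ j $ i" for i j
  proof (cases "weight_eq n a 0 i j")
    case True
    have "f $ q $ p * g $ (j - q) $ (i - p) = f $ q $ p * h $ (j - q) $ (i - p)"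
      if "q \<le> j" "p \<le> i" for p q
    proof (cases "f $ q $ p = 0")
      case False
      then have "weight_eq n a 0 (i - p) (j - q)"
        using True f that weight_eq_diff [of n a 0 0 "i - p" p "j - q" q]
        by (auto simp: weight_space_def)
      then show ?thesis by (simp add: g_def)
    qed simp
    then have "(f * g) $ j $ i = (f * h) $ j $ i"
      unfolding nth_mult_xy by (intro sum.cong) auto
    then show ?thesis by (simp add: h)
  next
    case False
    moreover have "f * g \<in> weight_space n a 0"
      using weight_space_mult [OF f g] by simp
    moreover have "(1 :: 'k fps fps) \<in> weight_space n a 0"
      by (rule one_in_weight_space)
    ultimately have "(f * g) $ j $ i = 0" "(1 :: 'k fps fps) $ j $ i = 0"
      unfolding weight_space_def by blast+
    then show ?thesis by simp
  qed
  then have "g * f = 1" by (intro fps_ext) (simp add: mult.commute)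
  then show ?thesis using g by blast
qed

section \<open>Minimal generators of the weight modules\<close>

locale cyclic_quotient =
  fixes n a :: nat and \<zeta> :: "'k::field"
  assumes primitive: "primitive_root_of_unity n \<zeta>"
begin

abbreviation R :: "'k fps fps ring" where "R \<equiv> invariant_ring (cyclic_group a \<zeta>)"

lemma n_pos: "n > 0"
  using primitive by (simp add: primitive_root_of_unity_def)

lemma R_simps [simp]:
  "carrier R = weight_space n a 0" "\<zero>\<^bsub>R\<^esub> = 0" "\<one>\<^bsub>R\<^esub> = 1"
  "x \<oplus>\<^bsub>R\<^esub> y = x + y" "x \<otimes>\<^bsub>R\<^esub> y = x * y"
  using carrier_invariant_ring [OF primitive] by (auto simp: invariant_ring_def)

lemma S_simps [simp]:
  "carrier S_module = UNIV" "\<zero>\<^bsub>S_module\<^esub> = 0"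
  "x \<oplus>\<^bsub>S_module\<^esub> y = x + y" "x \<odot>\<^bsub>S_module\<^esub> y = x * y"
  by (auto simp: S_module_def)

lemma abelian_group_R: "abelian_group R"
proof (rule abelian_groupI)
  show "\<exists>y\<in>carrier R. y \<oplus>\<^bsub>R\<^esub> x = \<zero>\<^bsub>R\<^esub>" if "x \<in> carrier R" for x
    using that by (intro bexI [of _ "- x"]) (auto simp: weight_space_uminus)
qed (auto simp: weight_space_add zero_in_weight_space)

lemma cring_R: "cring R"
proof (rule cringI [OF abelian_group_R])
  show "Group.comm_monoid R"
    using weight_space_mult [of _ n a 0 _ 0]
    by (intro comm_monoidI) (auto simp: one_in_weight_space)
qed (auto simp: algebra_simps)

sublocale S: Module.module R S_module
proof (rule moduleI [OF cring_R])
  show "abelian_group (S_module :: ('k fps fps, 'k fps fps) module)"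
  proof (rule abelian_groupI)
    show "\<exists>y\<in>carrier S_module. y \<oplus>\<^bsub>S_module\<^esub> x = \<zero>\<^bsub>S_module\<^esub>" for x :: "'k fps fps"
      by (intro bexI [of _ "- x"]) auto
  qed auto
qed (auto simp: algebra_simps)

lemma submodule_weight_space: "submodule R (weight_space n a t) S_module"
  using weight_space_mult [of _ n a 0 _ t]
  by (intro submodule.intro S.module_axioms)
    (auto simp: weight_space_add zero_in_weight_space)

text \<open>The span of the monomials of weight \<open>t\<close> contains all power series of that weight, although
  these may have infinitely many terms: finitely many minimal monomials suffice as generators,
  with power series as coefficients.\<close>

lemma M_module_eq: "M_module n a \<zeta> t = S_module\<lparr>carrier := weight_space n a t\<rparr>"
proof -
  let ?X = "{var_x ^ i * var_y ^ j | i j. [int i + int j * int a = t] (mod int n)} :: 'k fps fps set"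
  have X: "?X \<subseteq> weight_space n a t"
    using monomial_in_weight_space [of n a t] by (auto simp: weight_eq_def)
  have sub: "submodule R (S.span ?X) S_module"
    by (rule S.span_is_submodule) auto
  have gen: "?X \<subseteq> S.span ?X"
    by (rule S.in_own_span) auto
  have "S.span ?X = weight_space n a t"
  proof
    show "S.span ?X \<subseteq> weight_space n a t"
      by (rule S.span_is_subset [OF X submodule_weight_space])
    show "weight_space n a t \<subseteq> S.span ?X"
    proof
      fix f :: "'k fps fps" assume f_in: "f \<in> weight_space n a t"
      obtain r where r: "\<And>p q. (p, q) \<in> min_exponents n a t \<Longrightarrow> r (p, q) \<in> weight_space n a 0"
          "\<And>p q. (p, q) \<in> min_exponents n a t \<Longrightarrow> r (p, q) $ 0 $ 0 = f $ q $ p"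
        and f: "f = (\<Sum>(p, q)\<in>min_exponents n a t. r (p, q) * (var_x ^ p * var_y ^ q))"
        by (rule weight_space_decompose [OF n_pos f_in]) blast
      have "r (p, q) * (var_x ^ p * var_y ^ q) \<in> S.span ?X" if pq: "(p, q) \<in> min_exponents n a t" for p q
      proof -
        have "var_x ^ p * var_y ^ q \<in> S.span ?X"
          using pq gen by (auto simp: min_exponents_def weight_eq_def)
        then show ?thesis
          using submodule.smult_closed [OF sub, of "r (p, q)"] r(1) [OF pq] by simp
      qed
      then show "f \<in> S.span ?X"
        using submodule.zero_closed [OF sub] submodule.m_closed [OF sub]
        unfolding f by (intro sum_mem) auto
    qed
  qed
  then show ?thesis by (simp add: M_module_def)
qed

lemma max_ideal_R: "max_ideal R = {f \<in> weight_space n a 0. f $ 0 $ 0 = 0}"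
proof (rule max_ideal_eqI)
  interpret cring R by (rule cring_R)
  show "ideal {f \<in> weight_space n a 0. f $ 0 $ 0 = 0} R"
  proof (rule idealI)
    show "ring R" ..
    show "subgroup {f \<in> weight_space n a 0. f $ 0 $ 0 = 0} (add_monoid R)"
    proof (rule subgroup.intro)
      fix x :: "'k fps fps" assume x: "x \<in> {f \<in> weight_space n a 0. f $ 0 $ 0 = 0}"
      have "\<ominus>\<^bsub>R\<^esub> x = - x"
        using x by (intro abelian_group.minus_equality [OF abelian_group_R]) (auto simp: weight_space_uminus)
      then show "inv\<^bsub>add_monoid R\<^esub> x \<in> {f \<in> weight_space n a 0. f $ 0 $ 0 = 0}"
        using x by (auto simp: weight_space_uminus a_inv_def)
    qed (auto simp: weight_space_add zero_in_weight_space)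
  qed (use weight_space_mult [of _ n a 0 _ 0] in \<open>auto simp: fps_mult_nth\<close>)
  show "\<one>\<^bsub>R\<^esub> \<notin> {f \<in> weight_space n a 0. f $ 0 $ 0 = 0}" by simp
  show "\<exists>y\<in>carrier R. y \<otimes>\<^bsub>R\<^esub> x = \<one>\<^bsub>R\<^esub>"
    if "x \<in> carrier R" "x \<notin> {f \<in> weight_space n a 0. f $ 0 $ 0 = 0}" for x
    using that weight_space_inverse [of x n a] by auto
qed

text \<open>An explicit description of the product of the module with the maximal ideal: in a product of
  a non-constant invariant monomial and a monomial of weight \<open>t\<close>, the latter is a proper divisor of
  the same weight.\<close>

definition decomposables :: "int \<Rightarrow> 'k fps fps set" where
  "decomposables t = {f \<in> weight_space n a t. \<forall>i j. (i, j) \<in> min_exponents n a t \<longrightarrow> f $ j $ i = 0}"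

abbreviation M :: "int \<Rightarrow> ('k fps fps, 'k fps fps) module" where
  "M t \<equiv> M_module n a \<zeta> t"

lemma M_simps [simp]:
  "carrier (M t) = weight_space n a t" "\<zero>\<^bsub>M t\<^esub> = 0"
  "x \<oplus>\<^bsub>M t\<^esub> y = x + y" "x \<odot>\<^bsub>M t\<^esub> y = x * y"
  by (simp_all add: M_module_eq S_module_def)

lemma module_M: "Module.module R (M t)"
  unfolding M_module_eq by (rule S.submodule_is_module [OF submodule_weight_space])

text \<open>In the coefficient of the product at a minimal exponent, every summand has a factor zero:
  a monomial of \<open>z\<close> dividing a minimal one equals it, and then the other factor is the constant
  term of \<open>r\<close>.\<close>

lemma nth_max_ideal_mult:
  assumes r: "r \<in> max_ideal R" and z: "z \<in> weight_space n a t" and ij: "(i, j) \<in> min_exponents n a t"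
  shows "(r * z) $ j $ i = 0"
proof -
  have "r $ q $ p * z $ (j - q) $ (i - p) = 0" if "q \<le> j" "p \<le> i" for p q
  proof (rule ccontr)
    assume nz: "r $ q $ p * z $ (j - q) $ (i - p) \<noteq> 0"
    then have "weight_eq n a t (i - p) (j - q)" using z by (auto simp: weight_space_def)
    then have "i - p = i \<and> j - q = j"
      using ij diff_le_self [of i p] diff_le_self [of j q] unfolding min_exponents_def by blast
    then have "p = 0" "q = 0" using that by auto
    then show False using nz r by (simp add: max_ideal_R)
  qed
  then show ?thesis unfolding nth_mult_xy by (intro sum.neutral ballI) auto
qed

text \<open>Modulo the maximal ideal an invariant series is its constant term, and multiplication by
  a constant does not create monomials.\<close>

lemma submodule_decomposables: "submodule R (decomposables t) (M t)"
proof (intro submodule.intro module_M)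
  fix c v assume c: "c \<in> carrier R" and v: "v \<in> decomposables t"
  have "c + - const_xy (c $ 0 $ 0) \<in> weight_space n a 0"
    using c by (intro weight_space_add weight_space_uminus const_xy_in_weight_space) simp
  then have "c - const_xy (c $ 0 $ 0) \<in> weight_space n a 0" by simp
  then have "c - const_xy (c $ 0 $ 0) \<in> max_ideal R"
    by (simp add: max_ideal_R const_xy_def)
  then have "((c - const_xy (c $ 0 $ 0)) * v) $ j $ i = 0" if "(i, j) \<in> min_exponents n a t" for i j
    using nth_max_ideal_mult that v by (auto simp: decomposables_def)
  then have "(c * v) $ j $ i = c $ 0 $ 0 * v $ j $ i" if "(i, j) \<in> min_exponents n a t" for i j
    using that by (simp add: left_diff_distrib nth_const_xy_mult)
  then show "c \<odot>\<^bsub>M t\<^esub> v \<in> decomposables t"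
    using c v weight_space_mult [of c n a 0 v t] by (auto simp: decomposables_def)
qed (auto simp: decomposables_def weight_space_add zero_in_weight_space)

lemma max_ideal_mult_M: "ideal_mult R (max_ideal R) (M t) = decomposables t"
proof -
  interpret M: Module.module R "M t" by (rule module_M)
  let ?X = "{r \<odot>\<^bsub>M t\<^esub> z | r z. r \<in> max_ideal R \<and> z \<in> carrier (M t)}"
  have mem: "r * z \<in> decomposables t" if "r \<in> max_ideal R" "z \<in> weight_space n a t" for r z
    using that nth_max_ideal_mult [OF that] weight_space_mult [of r n a 0 z t]
    by (auto simp: decomposables_def max_ideal_R)
  have X: "?X \<subseteq> decomposables t" using mem by auto
  have Xc: "?X \<subseteq> carrier (M t)" using X by (auto simp: decomposables_def)
  have sub: "submodule R (M.span ?X) (M t)"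
    by (rule M.span_is_submodule [OF Xc])
  have gen: "?X \<subseteq> M.span ?X"
    by (rule M.in_own_span [OF Xc])
  have "decomposables t \<subseteq> M.span ?X"
  proof
    fix f assume f: "f \<in> decomposables t"
    then have f_in: "f \<in> weight_space n a t" by (simp add: decomposables_def)
    obtain r where r: "\<And>p q. (p, q) \<in> min_exponents n a t \<Longrightarrow> r (p, q) \<in> weight_space n a 0"
        "\<And>p q. (p, q) \<in> min_exponents n a t \<Longrightarrow> r (p, q) $ 0 $ 0 = f $ q $ p"
      and feq: "f = (\<Sum>(p, q)\<in>min_exponents n a t. r (p, q) * (var_x ^ p * var_y ^ q))"
      by (rule weight_space_decompose [OF n_pos f_in]) blast
    have "r w * (var_x ^ fst w * var_y ^ snd w) \<in> M.span ?X" if w: "w \<in> min_exponents n a t" for w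
    proof -
      obtain p q where w: "w = (p, q)" "(p, q) \<in> min_exponents n a t" using w by (cases w) auto
      have "r w \<in> max_ideal R"
        using r [OF w(2)] f w by (auto simp: max_ideal_R decomposables_def)
      moreover have "var_x ^ p * var_y ^ q \<in> weight_space n a t"
        using w by (intro monomial_in_weight_space) (simp add: min_exponents_def)
      ultimately show ?thesis using gen w(1) by auto
    qed
    then show "f \<in> M.span ?X"
      using submodule.zero_closed [OF sub] submodule.m_closed [OF sub]
      unfolding feq by (intro sum_mem) auto
  qed
  then have "M.span ?X = decomposables t"
    using M.span_is_subset [OF X submodule_decomposables] by auto
  then show ?thesis by (simp add: ideal_mult_def)
qed

text \<open>The cosets of the minimal monomials form a basis of the quotient: the coefficients at the
  minimal exponents are well defined on cosets, are dual to these monomials, and vanish together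
  only on the zero coset.\<close>

lemma min_num_gens_M: "min_num_gens const_xy R (M t) = card (min_exponents n a t)"
proof -
  let ?N = "decomposables t" and ?K = "class_ring :: 'k ring"
  let ?V = "restrict_scalars const_xy (quot_module (M t) ?N)"
  interpret N: submodule R ?N "M t" by (rule submodule_decomposables)
  interpret M: Module.module R "M t" by (rule module_M)
  interpret A: abelian_subgroup ?N "M t" by (rule N.abelian_subgroup_add)
  let ?coset = "\<lambda>f. ?N +>\<^bsub>M t\<^esub> f"
  have hom: "const_xy \<in> Ring.ring_hom ?K R"
    by (auto simp: Ring.ring_hom_def const_xy_in_weight_space) (simp_all add: const_xy_def flip: fps_const_add fps_const_mult)
  have "Module.module ?K ?V"
    by (rule restrict_scalars_is_module [OF N.quot_module_is_module _ hom]) (rule fieldE(1) [OF class_field])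
  then interpret V: vectorspace ?K ?V
    by (intro vectorspace.intro) (auto intro: class_field)
  have cosetE: "\<exists>f\<in>weight_space n a t. X = ?coset f" if "X \<in> carrier ?V" for X
    using that by (auto simp: restrict_scalars_def quot_module_def A_RCOSETS_def')
  have coset: "?coset f \<in> carrier ?V" if "f \<in> weight_space n a t" for f
    using that by (auto simp: restrict_scalars_def quot_module_def A_RCOSETS_def')
  \<comment> \<open>Any representative of the coset gives the same coefficient at a minimal exponent.\<close>
  define c where "c = (\<lambda>(i, j) X. (SOME f. f \<in> X) $ j $ i :: 'k)"
  have c: "c (i, j) (?coset f) = f $ j $ i"
    if ij: "(i, j) \<in> min_exponents n a t" and f: "f \<in> weight_space n a t" for i j f
  proof -
    have "f \<in> ?coset f" using f by (simp add: A.a_rcos_self)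
    then have "(SOME f'. f' \<in> ?coset f) \<in> ?coset f" by (rule someI)
    then obtain h where "h \<in> ?N" "(SOME f'. f' \<in> ?coset f) = h + f"
      by (auto simp: a_r_coset_def')
    then show ?thesis using ij by (auto simp: c_def decomposables_def)
  qed
  have add: "?coset f \<oplus>\<^bsub>?V\<^esub> ?coset g = ?coset (f + g)"
    if "f \<in> weight_space n a t" "g \<in> weight_space n a t" for f g
    using that A.a_rcos_sum [of f g] by (simp add: restrict_scalars_def quot_module_def)
  have smult: "k \<odot>\<^bsub>?V\<^esub> ?coset f = ?coset (const_xy k * f)" if "f \<in> weight_space n a t" for k f
    using that N.smult_coset [of "const_xy k" f] by (simp add: restrict_scalars_def const_xy_in_weight_space)
  have zero: "\<zero>\<^bsub>?V\<^esub> = ?N"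
    by (simp add: restrict_scalars_def quot_module_def)
  have "V.dim = card (min_exponents n a t)"
  proof (rule V.dim_eq_card_of_coordinates [where c = c and e = "\<lambda>(p, q). ?coset (var_x ^ p * var_y ^ q)"])
    show "finite (min_exponents n a t)" by (rule finite_min_exponents [OF n_pos])
    have mono: "(var_x ^ p * var_y ^ q :: 'k fps fps) \<in> weight_space n a t" if "(p, q) \<in> min_exponents n a t" for p q
      using that by (intro monomial_in_weight_space) (simp add: min_exponents_def)
    fix w assume w: "w \<in> min_exponents n a t"
    obtain i j where ij: "w = (i, j)" by (cases w)
    show "(case w of (p, q) \<Rightarrow> ?coset (var_x ^ p * var_y ^ q)) \<in> carrier ?V"
      using w ij mono coset by simp
    show "c w v \<in> carrier ?K" for v by simp
    show "c w (case w' of (p, q) \<Rightarrow> ?coset (var_x ^ p * var_y ^ q)) =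
        (if w = w' then \<one>\<^bsub>?K\<^esub> else \<zero>\<^bsub>?K\<^esub>)" if "w' \<in> min_exponents n a t" for w'
      using w ij that mono by (cases w') (auto simp: c nth_monomial)
    fix u assume "u \<in> carrier ?V"
    then obtain f where f: "f \<in> weight_space n a t" "u = ?coset f" using cosetE by blast
    show "c w (r \<odot>\<^bsub>?V\<^esub> u) = r \<otimes>\<^bsub>?K\<^esub> c w u" for r
      using w ij f weight_space_mult [OF const_xy_in_weight_space f(1), of r]
      by (simp add: smult c nth_const_xy_mult)
    fix v assume "v \<in> carrier ?V"
    then obtain g where g: "g \<in> weight_space n a t" "v = ?coset g" using cosetE by blast
    show "c w (u \<oplus>\<^bsub>?V\<^esub> v) = c w u \<oplus>\<^bsub>?K\<^esub> c w v"
      using w ij f g by (simp add: add c weight_space_add)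
  next
    fix v assume "v \<in> carrier ?V" and v: "\<And>w. w \<in> min_exponents n a t \<Longrightarrow> c w v = \<zero>\<^bsub>?K\<^esub>"
    then obtain f where f: "f \<in> weight_space n a t" "v = ?coset f" using cosetE by blast
    then have "f \<in> ?N" using v c by (fastforce simp: decomposables_def)
    then show "v = \<zero>\<^bsub>?V\<^esub>" using f zero A.a_rcos_const by simp
  qed
  then show ?thesis by (simp add: min_num_gens_def max_ideal_mult_M)
qed

end

section \<open>Records of a walk modulo n\<close>

definition records :: "(nat \<Rightarrow> int) \<Rightarrow> nat set" where
  "records s = {j. \<forall>j'<j. s j < s j'}"

text \<open>For the weight \<open>t\<close> and exponent \<open>j\<close> of \<open>y\<close>, this is the least possible exponent of \<open>x\<close>.\<close>

definition walk :: "int \<Rightarrow> int \<Rightarrow> int \<Rightarrow> nat \<Rightarrow> int" where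
  "walk n a t j = (t - int j * a) mod n"

text \<open>The walk descends in steps of \<open>a\<close> and is raised by \<open>n\<close> whenever it would become negative.
  Just before each raise it lies below \<open>a\<close>. After \<open>k\<close> raises its value at time \<open>j\<close> is
  \<open>t + k * n - j * a\<close>, so the visit below \<open>a\<close> takes place at the integer part of
  \<open>(t + k * n) / a\<close>.\<close>

definition visit :: "int \<Rightarrow> int \<Rightarrow> int \<Rightarrow> nat \<Rightarrow> nat" where
  "visit n a t k = nat ((t + int k * n) div a)"

lemma int_visit:
  assumes "0 < a" "0 \<le> n" "0 \<le> t"
  shows "int (visit n a t k) = (t + int k * n) div a"
  using assms by (simp add: visit_def pos_imp_zdiv_nonneg_iff)

lemma walk_visit:
  assumes "0 < a" "a \<le> n" "0 \<le> t"
  shows "walk n a t (visit n a t k) = (t + int k * n) mod a"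
proof -
  let ?q = "(t + int k * n) div a" and ?r = "(t + int k * n) mod a"
  have "t - ?q * a = ?r - int k * n"
    by (simp add: minus_div_mult_eq_mod [symmetric] algebra_simps)
  then have "walk n a t (visit n a t k) = (?r - int k * n) mod n"
    using assms by (simp add: walk_def int_visit)
  also have "\<dots> = ?r mod n"
    using mod_mult_self1 [of "?r - int k * n" "int k" n] by simp
  also have "\<dots> = ?r"
    using assms pos_mod_bound [of a "t + int k * n"] pos_mod_sign [of a "t + int k * n"]
    by (intro mod_pos_pos_trivial) linarith+
  finally show ?thesis .
qed

text \<open>The integer part of \<open>(t - j * a) / n\<close> is minus the number of raises up to time \<open>j\<close>.\<close>

lemma walk_low_imp_visit:
  assumes "0 < a" "a \<le> n" "0 \<le> t" "t < n" "walk n a t j < a"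
  shows "\<exists>k. j = visit n a t k"
proof -
  let ?m = "t - int j * a"
  have "?m div n \<le> 0"
  proof -
    have "?m \<le> t" using assms by simp
    then have "?m div n \<le> t div n" using assms by (intro zdiv_mono1) auto
    then show ?thesis using assms by simp
  qed
  define k where "k = nat (- (?m div n))"
  have k: "int k = - (?m div n)"
    using \<open>?m div n \<le> 0\<close> by (simp add: k_def)
  have "t + int k * n = walk n a t j + int j * a"
    unfolding k walk_def by (simp add: minus_div_mult_eq_mod [symmetric] algebra_simps)
  moreover have "0 \<le> walk n a t j"
    using assms by (simp add: walk_def)
  ultimately have "(t + int k * n) div a = int j"
    using assms by simp
  then show ?thesis
    by (intro exI [of _ k]) (simp add: visit_def)
qed

lemma visit_strict_mono:
  assumes "0 < a" "a \<le> n" "0 \<le> t"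
  shows "strict_mono (visit n a t)"
proof (rule strict_mono_Suc_iff [THEN iffD2], rule allI)
  fix k
  have "(t + int k * n) div a + 1 = (t + int k * n + a) div a"
    using assms by simp
  also have "\<dots> \<le> (t + int (Suc k) * n) div a"
    using assms by (intro zdiv_mono1) (auto simp: algebra_simps)
  finally show "visit n a t k < visit n a t (Suc k)"
    using int_visit [of a n t k] int_visit [of a n t "Suc k"] assms by linarith
qed

lemma walk_before_first_visit:
  assumes "0 < a" "0 \<le> t" "t < n" "j < visit n a t 0"
  shows "walk n a t j = t - int j * a" "a \<le> t - int j * a"
proof -
  have "int j + 1 \<le> t div a"
    using assms by (simp add: visit_def)
  then have "(int j + 1) * a \<le> t div a * a"
    using assms by (intro mult_right_mono) auto
  also have "\<dots> \<le> t"
    using assms by (metis minus_mod_eq_div_mult diff_le_eq le_add_same_cancel1 pos_mod_sign)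
  finally show *: "a \<le> t - int j * a"
    by (simp add: algebra_simps)
  have "0 \<le> int j * a" using assms by simp
  with * show "walk n a t j = t - int j * a"
    using assms unfolding walk_def by (intro mod_pos_pos_trivial) linarith+
qed

text \<open>
  Before its first visit below \<open>a\<close> the walk descends without a raise, so all of these times are
  records, and so is that visit. Afterwards a record must lie below \<open>a\<close>, hence occur at a visit.
  The values at the visits are \<open>(t + k * n) mod a\<close>, and since \<open>n\<close> is congruent to \<open>- b\<close>
  modulo \<open>a\<close>, they form the walk for \<open>a\<close>, \<open>b\<close> and \<open>t mod a\<close>. Visits are ordered in
  time, and all other values are at least \<open>a\<close>, so the records among the visits are the
  records of this smaller walk.
\<close>

lemma records_walk_reduce:
  assumes "0 < a" "a \<le> n" "0 \<le> t" "t < n" "n = \<alpha> * a - b"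
  shows "records (walk n a t) =
    {..<visit n a t 0} \<union> visit n a t ` records (walk a b (t mod a))"
proof -
  let ?s = "walk n a t" and ?v = "visit n a t" and ?s' = "walk a b (t mod a)"
  have sv: "?s (?v k) = ?s' k" for k
  proof -
    have "t + int k * n = t - int k * b + (int k * \<alpha>) * a"
      unfolding assms(5) by (simp add: algebra_simps)
    then have "(t + int k * n) mod a = (t - int k * b) mod a"
      by (metis mod_mult_self1)
    then show ?thesis
      using walk_visit [OF assms(1-3)] by (simp add: walk_def mod_diff_left_eq)
  qed
  have low: "?s' k < a" for k
    using assms by (simp add: walk_def)
  have high: "a \<le> ?s j" if "j \<notin> range ?v" for j
    using walk_low_imp_visit [OF assms(1-4), of j] that by force
  have mono: "strict_mono ?v"
    by (rule visit_strict_mono [OF assms(1-3)])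
  have first: "?s j' > ?s j" if "j' < j" "j' < ?v 0" "j \<le> ?v 0" for j j'
  proof (cases "j = ?v 0")
    case True
    then show ?thesis
      using walk_before_first_visit [OF assms(1,3,4) that(2)] sv [of 0] low [of 0] by simp
  next
    case False
    then show ?thesis
      using that walk_before_first_visit [OF assms(1,3,4), of j]
        walk_before_first_visit [OF assms(1,3,4), of j'] assms(1) by simp
  qed
  have "j \<in> {..<?v 0} \<union> ?v ` records ?s'" if "j \<in> records ?s" for j
  proof (cases "j < ?v 0")
    case False
    have "j \<in> range ?v"
    proof (cases "j = ?v 0")
      case False
      with \<open>\<not> j < ?v 0\<close> that have "?s j < ?s (?v 0)" by (simp add: records_def)
      then show ?thesis using high [of j] sv [of 0] low [of 0] by force
    qed auto
    then obtain k where k: "j = ?v k" by auto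
    have "k \<in> records ?s'"
      unfolding records_def
    proof safe
      fix k' assume "k' < k"
      then have "?v k' < ?v k" using mono by (simp add: strict_mono_less)
      with that k have "?s (?v k) < ?s (?v k')" by (simp add: records_def)
      then show "?s' k < ?s' k'" by (simp add: sv)
    qed
    then show ?thesis using k by auto
  qed auto
  moreover have "j \<in> records ?s" if "j < ?v 0" for j
    using first that by (simp add: records_def)
  moreover have "?v k \<in> records ?s" if k: "k \<in> records ?s'" for k
    unfolding records_def
  proof safe
    fix j' assume j': "j' < ?v k"
    show "?s (?v k) < ?s j'"
    proof (cases "j' \<in> range ?v")
      case True
      then obtain k' where k': "j' = ?v k'" by auto
      then have "k' < k" using j' mono by (simp add: strict_mono_less)
      then show ?thesis using k k' by (simp add: records_def sv)
    next
      case False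
      then show ?thesis using high [of j'] low [of k] sv [of k] by simp
    qed
  qed
  ultimately show ?thesis by auto
qed

lemma card_records_walk_reduce:
  assumes "0 < a" "a \<le> n" "0 \<le> t" "t < n" "n = \<alpha> * a - b"
    and fin: "finite (records (walk a b (t mod a)))"
  shows "finite (records (walk n a t))"
    and "int (card (records (walk n a t))) = t div a + int (card (records (walk a b (t mod a))))"
proof -
  let ?v = "visit n a t" and ?R = "records (walk a b (t mod a))"
  have mono: "strict_mono ?v"
    by (rule visit_strict_mono [OF assms(1-3)])
  have disj: "{..<?v 0} \<inter> ?v ` ?R = {}"
    using mono by (auto simp: strict_mono_less)
  have "card (?v ` ?R) = card ?R"
    using mono by (intro card_image strict_mono_imp_inj_on)
  then have "card (records (walk n a t)) = ?v 0 + card ?R"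
    unfolding records_walk_reduce [OF assms(1-5)] using fin disj by (simp add: card_Un_disjoint)
  then show "int (card (records (walk n a t))) = t div a + int (card ?R)"
    using int_visit [of a n t 0] assms by simp
  show "finite (records (walk n a t))"
    unfolding records_walk_reduce [OF assms(1-5)] using fin by simp
qed

text \<open>The pair \<open>(1, 0)\<close> is where the Euclidean descent stops.\<close>

lemma records_walk_trivial: "records (walk 1 0 t) = {0}"
  by (auto simp: records_def walk_def)

section \<open>Records and the i-series\<close>

lemma i_series_shift:
  assumes "int b = \<alpha> * int a - int n"
  shows "i_series a b \<alpha>s u = i_series n a (\<alpha> # \<alpha>s) (Suc u)"
  by (induction u rule: induct_nat_012) (simp_all add: assms)

lemma div_rem_shift: "div_rem i t (Suc u) = div_rem (i \<circ> Suc) (t mod i 1) u"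
  by (induction u) auto

lemma sum_div_quot_Suc:
  "(\<Sum>u = 1..Suc r. div_quot i t u) = t div i 1 + (\<Sum>u = 1..r. div_quot (i \<circ> Suc) (t mod i 1) u)"
proof -
  have "div_quot i t (Suc u) = div_quot (i \<circ> Suc) (t mod i 1) u" if "1 \<le> u" for u
    using that div_rem_shift [of i t "u - 1"] by (simp add: div_quot_def)
  then have "(\<Sum>u = 1..r. div_quot i t (Suc u)) = (\<Sum>u = 1..r. div_quot (i \<circ> Suc) (t mod i 1) u)"
    by (intro sum.cong) auto
  moreover have "(\<Sum>u = 1..Suc r. div_quot i t u) = div_quot i t 1 + (\<Sum>u = 1..r. div_quot i t (Suc u))"
    using sum.atLeast_Suc_atMost [of 1 "Suc r" "div_quot i t"]
      sum.shift_bounds_cl_Suc_ivl [of "div_quot i t" 1 r] by simp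
  ultimately show ?thesis by (simp add: div_quot_def)
qed

text \<open>Applied to the tail of an expansion of \<open>n / a\<close>, this makes the remainder \<open>\<alpha> * a - n\<close>, which
  is \<open>a\<close> divided by the value of the tail, positive and smaller than \<open>a\<close>.\<close>

lemma hj_cf_gt_1:
  "\<alpha>s \<noteq> [] \<Longrightarrow> \<forall>\<alpha>\<in>set \<alpha>s. 2 \<le> \<alpha> \<Longrightarrow> 1 < hj_cf \<alpha>s"
proof (induction \<alpha>s rule: hj_cf.induct)
  case (3 \<alpha> \<beta> \<alpha>s)
  then have "1 < hj_cf (\<beta> # \<alpha>s)" by simp
  then have "1 / hj_cf (\<beta> # \<alpha>s) < 1" by simp
  moreover have "(2::rat) \<le> of_int \<alpha>"
    using 3(3) by (metis list.set_intros(1) of_int_le_iff of_int_numeral)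
  ultimately show ?case by simp
qed auto

text \<open>
  Induction on the continued fraction. A step \<open>n / a = \<alpha> - b / a\<close> replaces \<open>(n, a)\<close> by
  \<open>(a, b)\<close>, removes the first entry of the i-series and replaces \<open>t\<close> by \<open>t mod a\<close>; it loses
  \<open>t div a\<close> records, which is the first quotient of the successive division. At the end one
  record remains, the source of the final summand \<open>1\<close>.
\<close>

lemma card_records_walk:
  assumes "1 \<le> a" "a < n" "coprime a n"
    and "hj_expansion \<alpha>s (of_nat n / of_nat a)"
    and "0 \<le> t" "t < int n"
  shows "finite (records (walk (int n) (int a) t)) \<and>
    int (card (records (walk (int n) (int a) t))) =
      (\<Sum>u = 1..length \<alpha>s. div_quot (i_series n a \<alpha>s) t u) + 1"
  using assms
proof (induction \<alpha>s arbitrary: n a t)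
  case Nil
  then show ?case by (simp add: hj_expansion_def)
next
  case (Cons \<alpha> \<alpha>s)
  note IH = Cons.IH and prems = Cons.prems
  let ?i = "i_series n a (\<alpha> # \<alpha>s)"
  have cf: "of_nat n / of_nat a = hj_cf (\<alpha> # \<alpha>s)" and \<alpha>: "2 \<le> \<alpha>" "\<forall>\<alpha>\<in>set \<alpha>s. 2 \<le> \<alpha>"
    using prems by (auto simp: hj_expansion_def)
  have a: "0 < (of_nat a :: rat)" using prems by simp
  have "\<exists>b. int b = \<alpha> * int a - int n \<and>
      finite (records (walk (int a) (int b) (t mod int a))) \<and>
      int (card (records (walk (int a) (int b) (t mod int a)))) =
        (\<Sum>u = 1..length \<alpha>s. div_quot (i_series a b \<alpha>s) (t mod int a) u) + 1"
  proof (cases \<alpha>s)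
    case Nil
    then have "(of_nat n :: rat) = of_int \<alpha> * of_nat a"
      using cf a by (simp add: field_simps)
    then have n: "int n = \<alpha> * int a"
      by (metis of_int_eq_iff of_int_mult of_int_of_nat_eq)
    \<comment> \<open>The last partial quotient: \<open>n\<close> is a multiple of \<open>a\<close>, so coprimality forces \<open>a = 1\<close>, \<open>b = 0\<close>.\<close>
    then have "a dvd n" by (metis dvd_triv_right int_dvd_int_iff)
    then have "a = 1" using prems by (metis coprime_absorb_left nat_dvd_1_iff_1)
    then show ?thesis
      using n Nil by (intro exI [of _ 0]) (simp add: records_walk_trivial)
  next
    case (Cons \<beta> \<beta>s)
    let ?q = "hj_cf \<alpha>s"
    have q: "1 < ?q" using hj_cf_gt_1 [of \<alpha>s] \<alpha> Cons by simp
    have "of_nat n / of_nat a = of_int \<alpha> - 1 / ?q"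
      using cf Cons by simp
    then have e: "of_int (\<alpha> * int a - int n) = of_nat a / ?q"
      using a q by (simp add: field_simps)
    have "0 < (of_int (\<alpha> * int a - int n) :: rat)"
      unfolding e using a q by simp
    then have pos: "0 < \<alpha> * int a - int n" by (simp only: of_int_0_less_iff)
    have "of_int (\<alpha> * int a - int n) < (of_int (int a) :: rat)"
      unfolding e using a q by (simp add: field_simps)
    then have less: "\<alpha> * int a - int n < int a" by (simp only: of_int_less_iff)
    define b where "b = nat (\<alpha> * int a - int n)"
    have b: "int b = \<alpha> * int a - int n" using pos by (simp add: b_def)
    have "of_nat a / of_nat b = ?q"
    proof -
      have "(of_nat b :: rat) = of_nat a / ?q" using e b by (metis of_int_of_nat_eq)
      then show ?thesis using a q by simp
    qed
    moreover have "coprime b a"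
    proof -
      have "coprime (int b) (int a)"
      proof (rule coprimeI)
        fix c assume c: "c dvd int b" "c dvd int a"
        have "int n = \<alpha> * int a - int b" using b by simp
        then have "c dvd int n" using c by simp
        then show "is_unit c"
          using c prems coprime_common_divisor [of "int a" "int n" c] by simp
      qed
      then show ?thesis by simp
    qed
    ultimately show ?thesis
      using IH [of b a "t mod int a"] pos less \<alpha>(2) prems b \<open>\<alpha>s = \<beta> # \<beta>s\<close>
      by (intro exI [of _ b]) (simp add: hj_expansion_def del: hj_cf.simps)
  qed
  then obtain b where b: "int b = \<alpha> * int a - int n"
    and fin: "finite (records (walk (int a) (int b) (t mod int a)))"
    and card: "int (card (records (walk (int a) (int b) (t mod int a)))) =
        (\<Sum>u = 1..length \<alpha>s. div_quot (i_series a b \<alpha>s) (t mod int a) u) + 1"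
    by blast
  have "i_series a b \<alpha>s = ?i \<circ> Suc"
    by (rule ext) (simp add: i_series_shift [OF b])
  then have "(\<Sum>u = 1..length (\<alpha> # \<alpha>s). div_quot ?i t u) =
      t div int a + (\<Sum>u = 1..length \<alpha>s. div_quot (i_series a b \<alpha>s) (t mod int a) u)"
    using sum_div_quot_Suc [of ?i t "length \<alpha>s"] by simp
  moreover have "0 < int a" "int a \<le> int n" "0 \<le> t" "t < int n" "int n = \<alpha> * int a - int b"
    using prems b by auto
  ultimately show ?case
    using card_records_walk_reduce [OF _ _ _ _ _ fin, of "int n" \<alpha>] card by simp
qed

section \<open>Minimal monomials and records\<close>

lemma weight_eq_iff_walk:
  "weight_eq n a t i j \<longleftrightarrow> int i mod int n = walk (int n) (int a) t j"
  using cong_diff_iff_cong_0 [of "int i + int j * int a" t "int n"]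
    cong_diff_iff_cong_0 [of "int i" "t - int j * int a" "int n"]
  by (simp add: weight_eq_def walk_def cong_def algebra_simps)

text \<open>A minimal exponent pair has the least possible \<open>x\<close>-exponent for its \<open>y\<close>-exponent \<open>j\<close>, and
  it is minimal exactly when no smaller \<open>j\<close> allows an \<open>x\<close>-exponent as small, that is, when \<open>j\<close>
  is a record.\<close>

lemma card_min_exponents:
  assumes "n > 0"
  shows "card (min_exponents n a t) = card (records (walk (int n) (int a) t))"
proof -
  let ?s = "walk (int n) (int a) t"
  have s_nonneg: "0 \<le> ?s j" for j using assms by (simp add: walk_def)
  have s_le: "?s j \<le> int i" if "weight_eq n a t i j" for i j
    using that by (metis weight_eq_iff_walk of_nat_0_le_iff zmod_le_nonneg_dividend)
  have s_weight: "weight_eq n a t (nat (?s j)) j" for j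
    using assms by (simp add: weight_eq_iff_walk s_nonneg walk_def)
  have "inj_on snd (min_exponents n a t)"
  proof (rule inj_onI, clarsimp)
    fix i i' j assume "(i, j) \<in> min_exponents n a t" "(i', j) \<in> min_exponents n a t"
    then show "i = i'" unfolding min_exponents_def using nle_le by blast
  qed
  moreover have "snd ` min_exponents n a t = records ?s"
  proof (intro equalityI subsetI)
    fix j assume "j \<in> snd ` min_exponents n a t"
    then obtain i where ij: "(i, j) \<in> min_exponents n a t" by auto
    then have "?s j \<le> int i" by (intro s_le) (simp add: min_exponents_def)
    have "?s j < ?s j'" if "j' < j" for j'
    proof (rule ccontr)
      assume "\<not> ?s j < ?s j'"
      then have "nat (?s j') \<le> i" using \<open>?s j \<le> int i\<close> by linarith
      then have "j' = j"
        using ij s_weight [of j'] \<open>j' < j\<close> unfolding min_exponents_def by fastforce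
      with that show False by simp
    qed
    then show "j \<in> records ?s" by (simp add: records_def)
  next
    fix j assume j: "j \<in> records ?s"
    have "i' = nat (?s j) \<and> j' = j"
      if w: "weight_eq n a t i' j'" and le: "i' \<le> nat (?s j)" "j' \<le> j" for i' j'
    proof -
      have "int i' \<le> ?s j" using le s_nonneg [of j] by linarith
      then have "\<not> ?s j < ?s j'" using s_le [OF w] by linarith
      then have "\<not> j' < j" using j unfolding records_def by blast
      then have "j' = j" using le by simp
      moreover from this have "nat (?s j) \<le> i'" using s_le [OF w] by (simp add: nat_le_iff)
      ultimately show ?thesis using le by simp
    qed
    then have "(nat (?s j), j) \<in> min_exponents n a t"
      using s_weight [of j] by (auto simp: min_exponents_def)
    then show "j \<in> snd ` min_exponents n a t" by force
  qed
  ultimately show ?thesis by (metis card_image)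
qed

theorem theorem3p2:
  fixes \<zeta> :: "'k::alg_closed_field" and n a :: nat and t :: int and \<alpha>s :: "int list"
  assumes "1 \<le> a" and "a \<le> n - 1" and "coprime a n"
    and "of_nat n \<noteq> (0 :: 'k)"
    and "primitive_root_of_unity n \<zeta>"
    and "hj_expansion \<alpha>s (of_nat n / of_nat a)"
    and "0 \<le> t" and "t \<le> int n - 1"
  shows "int (min_num_gens const_xy (invariant_ring (cyclic_group a \<zeta>)) (M_module n a \<zeta> t)) =
    (\<Sum>u = 1..length \<alpha>s. div_quot (i_series n a \<alpha>s) t u) + 1"
proof -
  interpret cyclic_quotient n a \<zeta>
    by unfold_locales fact
  have "a < n" using assms(1,2) by linarith
  then show ?thesis
    using card_records_walk [of a n \<alpha>s t] assms
    by (simp add: min_num_gens_M card_min_exponents [OF n_pos])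
qed

end
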